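(* Let $(X,d)$ be an ultrametric space. Then the following statements are equivalent: (1) The space $(X,d)$ is totally bounded. (2) The space $(\bar{\mathbf{B}}_X, d_H)$ is totally bounded.
   Context: Metric spaces are nonempty. An ultrametric space is a metric space $(X,d)$ with $d(x,y)\le\max\{d(x,z),d(z,y)\}$ for all $x,y,z\in X$. For $c\in X$ and $r\ge 0$ the closed ball is $\bar B_r(c)=\{x\in X: d(c,x)\le r\}$ (so $\bar B_0(c)=\{c\}$). $\bar{\mathbf{B}}_X$ is the set of all closed balls $\bar B_r(c)$, $c\in X$, $r\ge 0$, regarded as subsets of $X$. The Hausdorff distance between nonempty closed bounded sets $A,B\subseteq X$ is $d_H(A,B)=\max\{\sup_{a\in A}\inf_{b\in B}d(a,b),\ \sup_{b\in B}\inf_{a\in A}d(a,b)\}$; $\bar{\mathbf{B}}_X$ is equipped with the metric $d_H$. *)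

theory Defs
  imports "HOL-Analysis.Analysis"
begin

locale Ultrametric_space = Metric_space +
  assumes ultra: "\<lbrakk>x \<in> M; y \<in> M; z \<in> M\<rbrakk> \<Longrightarrow> d x y \<le> max (d x z) (d z y)"

context Metric_space
begin

definition closed_balls :: "'a set set" where
  "closed_balls = {mcball c r |c r. c \<in> M \<and> 0 \<le> r}"

definition closed_bounded :: "'a set set" where
  "closed_bounded = {A. A \<noteq> {} \<and> closedin mtopology A \<and> mbounded A}"

text \<open>The value \<open>0\<close> outside \<^term>\<open>closed_bounded\<close> is a convention only: it makes the function
  total, and \<^locale>\<open>Metric_space\<close> asks for nonnegativity on the whole type.\<close>

definition hausdorff_dist :: "'a set \<Rightarrow> 'a set \<Rightarrow> real" where
  "hausdorff_dist A B =
     (if A \<in> closed_bounded \<and> B \<in> closed_bounded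
      then max (SUP a\<in>A. INF b\<in>B. d a b) (SUP b\<in>B. INF a\<in>A. d a b)
      else 0)"

lemma closed_bounded_subset: "A \<in> closed_bounded \<Longrightarrow> A \<subseteq> M"
  using closedin_subset[of mtopology A] by (simp add: closed_bounded_def)

lemma closed_balls_subset: "closed_balls \<subseteq> closed_bounded"
  unfolding closed_balls_def closed_bounded_def
  by (auto simp: mbounded_mcball)

lemma excess_le_iff:
  assumes A: "A \<in> closed_bounded" and B: "B \<in> closed_bounded"
  shows "(SUP a\<in>A. INF b\<in>B. d a b) \<le> r \<longleftrightarrow> (\<forall>a\<in>A. \<forall>s>r. \<exists>b\<in>B. d a b < s)"
proof -
  have ne: "A \<noteq> {}" "B \<noteq> {}" using A B by (auto simp: closed_bounded_def)
  have low: "bdd_below (d a ` B)" for a by (rule bdd_belowI2[of _ 0]) simp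
  have "mbounded (A \<union> B)" using A B by (simp add: closed_bounded_def mbounded_Un)
  then obtain k where k: "\<And>x y. \<lbrakk>x \<in> A \<union> B; y \<in> A \<union> B\<rbrakk> \<Longrightarrow> d x y \<le> k"
    unfolding mbounded_alt by blast
  obtain b0 where b0: "b0 \<in> B" using ne by blast
  have up: "bdd_above ((\<lambda>a. INF b\<in>B. d a b) ` A)"
  proof (rule bdd_aboveI2)
    fix a assume "a \<in> A"
    then show "(INF b\<in>B. d a b) \<le> k" using cINF_lower2[OF low b0] k b0 by blast
  qed
  have "(INF b\<in>B. d a b) \<le> r \<longleftrightarrow> (\<forall>s>r. \<exists>b\<in>B. d a b < s)" for a
    unfolding cINF_less_iff[OF ne(2) low, symmetric]
    by (meson dense_ge less_imp_le order_le_less_trans)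
  then show ?thesis by (simp add: cSUP_le_iff[OF ne(1) up])
qed

lemma hausdorff_dist_le_iff:
  assumes "A \<in> closed_bounded" "B \<in> closed_bounded"
  shows "hausdorff_dist A B \<le> r \<longleftrightarrow>
    (\<forall>a\<in>A. \<forall>s>r. \<exists>b\<in>B. d a b < s) \<and> (\<forall>b\<in>B. \<forall>s>r. \<exists>a\<in>A. d b a < s)"
  using assms excess_le_iff[of A B r] excess_le_iff[of B A r]
  by (simp add: hausdorff_dist_def commute)

lemma hausdorff_dist_nonneg: "0 \<le> hausdorff_dist A B"
proof (cases "A \<in> closed_bounded \<and> B \<in> closed_bounded")
  case True
  then obtain a where "a \<in> A" by (auto simp: closed_bounded_def)
  show ?thesis
  proof (rule ccontr)
    assume "\<not> ?thesis"
    then obtain b where "d a b < 0"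
      using True \<open>a \<in> A\<close> hausdorff_dist_le_iff[of A B "hausdorff_dist A B"]
      by (meson not_le order_refl)
    then show False using nonneg[of a b] by linarith
  qed
qed (auto simp: hausdorff_dist_def)

lemma hausdorff_dist_zero_subset:
  assumes "A \<in> closed_bounded" "B \<in> closed_bounded" "hausdorff_dist A B \<le> 0"
  shows "A \<subseteq> B"
proof
  fix a assume "a \<in> A"
  then have "\<exists>b\<in>B. b \<in> mball a s" if "s > 0" for s
    using that assms hausdorff_dist_le_iff[of A B 0] closed_bounded_subset
    by (meson in_mball subsetD)
  moreover have "a \<in> M" using \<open>a \<in> A\<close> assms(1) closed_bounded_subset by blast
  ultimately have "a \<in> mtopology closure_of B" by (auto simp: metric_closure_of)
  then show "a \<in> B" using assms(2) by (simp add: closed_bounded_def closure_of_closedin)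
qed

lemma hausdorff_dist_commute: "hausdorff_dist A B = hausdorff_dist B A"
  by (auto simp: hausdorff_dist_def commute max.commute)

lemma hausdorff_dist_triangle:
  assumes A: "A \<in> closed_bounded" and B: "B \<in> closed_bounded" and C: "C \<in> closed_bounded"
  shows "hausdorff_dist A C \<le> hausdorff_dist A B + hausdorff_dist B C"
proof -
  have *: "\<exists>c\<in>C. d a c < s"
    if A: "A \<in> closed_bounded" and C: "C \<in> closed_bounded" and a: "a \<in> A"
      and s: "hausdorff_dist A B + hausdorff_dist B C < s" for A C a s
  proof -
    define e where "e = (s - hausdorff_dist A B - hausdorff_dist B C) / 2"
    have e: "e > 0" using s by (simp add: e_def)
    obtain b where b: "b \<in> B" "d a b < hausdorff_dist A B + e"
      using a e hausdorff_dist_le_iff[OF A B, of "hausdorff_dist A B"]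
      by (meson less_add_same_cancel1 order_refl)
    obtain c where c: "c \<in> C" "d b c < hausdorff_dist B C + e"
      using b e hausdorff_dist_le_iff[OF B C, of "hausdorff_dist B C"]
      by (meson less_add_same_cancel1 order_refl)
    have "d a c \<le> d a b + d b c"
      using A B C a b c closed_bounded_subset by (meson subsetD triangle)
    then show ?thesis using b c by (intro bexI[of _ c]) (auto simp: e_def field_simps)
  qed
  show ?thesis
    using *[OF A C] *[OF C A]
    by (simp add: hausdorff_dist_le_iff[OF A C] hausdorff_dist_commute add.commute)
qed

lemma Metric_space_closed_bounded: "Metric_space closed_bounded hausdorff_dist"
proof
  fix A B assume AB: "A \<in> closed_bounded" "B \<in> closed_bounded"
  have "\<exists>b\<in>A. d a b < s" if "a \<in> A" "0 < s" for a s
    using that closed_bounded_subset[OF AB(1)] by (intro bexI[of _ a]) auto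
  then have "hausdorff_dist A A \<le> 0"
    by (simp add: hausdorff_dist_le_iff[OF AB(1) AB(1)])
  then show "hausdorff_dist A B = 0 \<longleftrightarrow> A = B"
    using AB hausdorff_dist_zero_subset[of A B] hausdorff_dist_zero_subset[of B A]
      hausdorff_dist_nonneg[of A A] hausdorff_dist_commute[of A B] by auto
qed (auto simp: hausdorff_dist_nonneg hausdorff_dist_commute hausdorff_dist_triangle)

lemma Metric_space_closed_balls: "Metric_space closed_balls hausdorff_dist"
  using Metric_space.subspace[OF Metric_space_closed_bounded closed_balls_subset] .

end

end

(* If K is a finite net of M, a closed bounded set A is determined up to small Hausdorff distance
   by the set of those points of K which are close to A; since K has only finitely many subsets,
   one representative for each of them gives a finite net of sets. Conversely, singletons are
   closed balls, and if {x} is close to a set B then x is close to every point of B, so any choice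
   of one point from each member of a finite net of balls gives a finite net of M. *)

theory Submission
  imports Defs
begin

context Metric_space
begin

text \<open>A point of \<open>A\<close> lies in some \<open>mball k e\<close>; by the equality of
  the traces that ball also meets \<open>B\<close>, and the triangle inequality through
  \<open>k\<close> gives a point of \<open>B\<close> at distance below \<open>2 * e\<close>.\<close>

lemma hausdorff_dist_le_if_same_trace:
  assumes A: "A \<in> closed_bounded" and B: "B \<in> closed_bounded"
    and cover: "M \<subseteq> (\<Union>k\<in>K. mball k e)"
    and same: "{k \<in> K. A \<inter> mball k e \<noteq> {}} = {k \<in> K. B \<inter> mball k e \<noteq> {}}"
  shows "hausdorff_dist A B \<le> 2 * e"
proof -
  have close: "\<exists>b\<in>B. d a b < 2 * e"
    if A: "A \<in> closed_bounded" and a: "a \<in> A"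
      and same: "{k \<in> K. A \<inter> mball k e \<noteq> {}} = {k \<in> K. B \<inter> mball k e \<noteq> {}}" for A B a
  proof -
    have "a \<in> M" using A a closed_bounded_subset by blast
    then obtain k where k: "k \<in> K" "a \<in> mball k e" using cover by blast
    then obtain b where b: "b \<in> B" "b \<in> mball k e" using same a by blast
    have "d a b \<le> d a k + d k b" using k b by (intro triangle) auto
    also have "\<dots> < 2 * e" using k b by (simp add: commute)
    finally show ?thesis using b by blast
  qed
  show ?thesis
    \<comment> \<open>The criterion asks for a point closer than every \<open>s > 2 * e\<close>; the
      strict bound \<open>2 * e\<close> serves all these \<open>s\<close> at once.\<close>
    unfolding hausdorff_dist_le_iff[OF A B]
    using close[OF A _ same] close[OF B _ same[symmetric]] less_trans by blast
qed

text \<open>The trace argument works for arbitrary closed bounded sets; closed balls inherit total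
  boundedness as a subset.\<close>

lemma mtotally_bounded_closed_bounded:
  assumes "mtotally_bounded M"
  shows "Metric_space.mtotally_bounded closed_bounded hausdorff_dist closed_bounded"
proof -
  interpret H: Metric_space closed_bounded hausdorff_dist
    by (rule Metric_space_closed_bounded)
  show ?thesis
    unfolding H.mtotally_bounded_def
  proof (intro allI impI)
    fix \<epsilon> :: real assume "\<epsilon> > 0"
    \<comment> \<open>Equal traces at radius \<epsilon>/4 bound the distance by \<epsilon>/2, which
      leaves room for the strict inequality in \<open>H.mball\<close>.\<close>
    then have "\<epsilon>/4 > 0" by simp
    then obtain K where K: "finite K" "M \<subseteq> (\<Union>k\<in>K. mball k (\<epsilon>/4))"
      using assms unfolding mtotally_bounded_def by metis
    define trace where "trace A = {k \<in> K. A \<inter> mball k (\<epsilon>/4) \<noteq> {}}" for A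
    have "trace ` closed_bounded \<subseteq> Pow K" by (auto simp: trace_def)
    then have "finite (trace ` closed_bounded)"
      by (rule finite_subset) (simp add: K)
    \<comment> \<open>One set is chosen for each of the finitely many traces that occur.\<close>
    from finite_subset_image[OF this order_refl]
    obtain C where C: "C \<subseteq> closed_bounded" "finite C" "trace ` closed_bounded = trace ` C"
      by metis
    have "A \<in> (\<Union>B\<in>C. H.mball B \<epsilon>)" if A: "A \<in> closed_bounded" for A
    proof -
      have "trace A \<in> trace ` C" using A C(3) by blast
      then obtain B where B: "B \<in> C" "trace B = trace A" by auto
      have "hausdorff_dist B A \<le> 2 * (\<epsilon>/4)"
      proof (rule hausdorff_dist_le_if_same_trace)
        show "B \<in> closed_bounded" using B(1) C(1) by (rule rev_subsetD)
      qed (use A K(2) B(2) in \<open>simp_all add: trace_def\<close>)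
      then have "hausdorff_dist B A < \<epsilon>" using \<open>\<epsilon> > 0\<close> by linarith
      then have "A \<in> H.mball B \<epsilon>" using A B(1) C(1) by auto
      then show ?thesis using B by blast
    qed
    then show "\<exists>C. finite C \<and> C \<subseteq> closed_bounded \<and> closed_bounded \<subseteq> (\<Union>B\<in>C. H.mball B \<epsilon>)"
      using C by blast
  qed
qed

lemma singleton_closed_ball:
  assumes "x \<in> M"
  shows "{x} \<in> closed_balls"
proof -
  have "y = x" if "y \<in> M" "d x y \<le> 0" for y
    using that assms zero[of x y] nonneg[of x y] by auto
  then have "{x} = mcball x 0" using assms by auto
  then show ?thesis using assms unfolding closed_balls_def by blast
qed

lemma dist_less_if_hausdorff_dist_singleton_less:
  assumes "B \<in> closed_bounded" "{x} \<in> closed_bounded" "hausdorff_dist B {x} < e" "b \<in> B"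
  shows "d b x < e"
proof -
  have "\<exists>y\<in>{x}. d b y < e"
    \<comment> \<open>The criterion is used with \<open>r\<close> equal to the distance itself, so
      that \<open>e\<close> is one of the admissible \<open>s > r\<close>.\<close>
    using hausdorff_dist_le_iff[OF assms(1,2)] assms(3,4) order_refl by metis
  then show ?thesis by simp
qed

lemma mtotally_bounded_if_mtotally_bounded_closed_balls:
  assumes "Metric_space.mtotally_bounded closed_balls hausdorff_dist closed_balls"
  shows "mtotally_bounded M"
  unfolding mtotally_bounded_def
proof (intro allI impI)
  interpret H: Metric_space closed_balls hausdorff_dist
    by (rule Metric_space_closed_balls)
  fix \<epsilon> :: real assume "\<epsilon> > 0"
  then obtain C where C: "finite C" "C \<subseteq> closed_balls" "closed_balls \<subseteq> (\<Union>B\<in>C. H.mball B \<epsilon>)"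
    using assms unfolding H.mtotally_bounded_def by metis
  \<comment> \<open>A ball is only a set here and need not determine its centre; any of its points
    will do.\<close>
  define p where "p B = (SOME b. b \<in> B)" for B :: "'a set"
  have bounded: "B \<in> closed_bounded" if "B \<in> closed_balls" for B
    using that closed_balls_subset by blast
  have p: "p B \<in> B" if "B \<in> closed_balls" for B
    using bounded[OF that] unfolding p_def closed_bounded_def by (simp add: some_in_eq)
  have p_M: "p B \<in> M" if "B \<in> closed_balls" for B
    using p[OF that] bounded[OF that] closed_bounded_subset by blast
  have "x \<in> (\<Union>c\<in>p ` C. mball c \<epsilon>)" if x: "x \<in> M" for x
  proof -
    have x': "{x} \<in> closed_balls" using x by (rule singleton_closed_ball)
    then obtain B where B: "B \<in> C" "{x} \<in> H.mball B \<epsilon>" using C(3) by blast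
    then have "B \<in> closed_balls" "hausdorff_dist B {x} < \<epsilon>" by auto
    then have "d (p B) x < \<epsilon>"
      using dist_less_if_hausdorff_dist_singleton_less[OF bounded bounded[OF x'] _ p] by blast
    then show ?thesis using B(1) x p_M[OF \<open>B \<in> closed_balls\<close>] by auto
  qed
  then show "\<exists>K. finite K \<and> K \<subseteq> M \<and> M \<subseteq> (\<Union>x\<in>K. mball x \<epsilon>)"
    using C(1,2) p_M by (intro exI[of _ "p ` C"] conjI) auto
qed

lemma mtotally_bounded_iff_closed_balls:
  "mtotally_bounded M \<longleftrightarrow> Metric_space.mtotally_bounded closed_balls hausdorff_dist closed_balls"
proof
  interpret H: Metric_space closed_bounded hausdorff_dist
    by (rule Metric_space_closed_bounded)
  assume "mtotally_bounded M"
  then have "H.mtotally_bounded closed_balls"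
    using H.mtotally_bounded_subset closed_balls_subset mtotally_bounded_closed_bounded by blast
  \<comment> \<open>So far the balls of the net are taken in \<open>closed_bounded\<close>; total
    boundedness does not depend on this ambient space.\<close>
  then show "Metric_space.mtotally_bounded closed_balls hausdorff_dist closed_balls"
    using H.mtotally_bounded_absolute by blast
qed (rule mtotally_bounded_if_mtotally_bounded_closed_balls)

end

theorem theorem5p12:
  fixes M :: "'a set" and d :: "'a \<Rightarrow> 'a \<Rightarrow> real"
  assumes "Ultrametric_space M d" and "M \<noteq> {}"
  shows "Metric_space.mtotally_bounded M d M \<longleftrightarrow>
    Metric_space.mtotally_bounded
      (Metric_space.closed_balls M d) (Metric_space.hausdorff_dist M d)
      (Metric_space.closed_balls M d)"
  using assms(1) Metric_space.mtotally_bounded_iff_closed_balls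
  by (auto simp: Ultrametric_space_def)

end
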